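(* Let $\Bbbk$ be a field, $S=\Bbbk[x_0,\ldots,x_n]$, and let $I\subseteq S$ be an ideal of projective dimension zero. Put $R=S/I$ and suppose that $\Bbbk$ contains at least $|V(I)|$ elements. Let $e_1,\ldots,e_m$ be forms of degree $\mathrm{nz}(R)$ such that $\{[e_1],\ldots,[e_m]\}$ is a $\Bbbk$-basis of $R_{\mathrm{nz}(R)}$, and let $l\in S_1$ be a linear form such that $\{[e_1l],\ldots,[e_ml]\}$ is a $\Bbbk$-basis of $R_{\mathrm{nz}(R)+1}$. Let $A_0,\ldots,A_n$ be the projective multiplication matrices with respect to these bases, i.e. $A_j$ is the $m\times m$ matrix over $\Bbbk$ with $[x_j][e_k]=\sum_{h=1}^m (A_j)_{kh}[e_hl]$ for $k=1,\ldots,m$. Let $r=|V(I)|$ and $V(I)=\{p_1,\ldots,p_r\}$. Then, up to multiplication by non-zero scalars, there are exactly $r$ common (right) eigenvectors in $\Bbbk^m$ for the matrices $A_0,\ldots,A_n$, and they are $(e_1(p_i),\ldots,e_m(p_i))^t$ for $i=1,\ldots,r$. Moreover, if $\lambda_{ij}$ denotes the eigenvalue of $A_j$ corresponding to the eigenvector $(e_1(p_i),\ldots,e_m(p_i))^t$, then $p_i=(\lambda_{i0}:\lambda_{i1}:\cdots:\lambda_{in})$.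
   Context: An ideal $I\subseteq S=\Bbbk[x_0,\ldots,x_n]$ is of projective dimension zero if $R=S/I$ is graded (i.e. $I$ is homogeneous) and there is $m>0$ with $\dim_\Bbbk R_i=m$ for all sufficiently large $i$. For such a ring, $\mathrm{post}(R)$ is the least $i$ such that $\dim_\Bbbk R_i=\dim_\Bbbk R_{i+1}=\cdots$. Taking a minimal primary decomposition of $I$, $I^u$ denotes the intersection of those primary components whose radical is not $\mathfrak m=(x_0,\ldots,x_n)$, and $R^u=S/I^u$. Set $\mathrm{nz}(R)=\max(\mathrm{post}(R),\mathrm{post}(R^u))$. $[a]$ denotes the class in $R$ of $a\in S$. $V(I)\subseteq\mathbb P^n(\Bbbk)$ is the set of $\Bbbk$-rational projective zeros of $I$. For each projective point a representative coordinate vector is fixed, and a form is evaluated at the point by evaluating it at this vector. *)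

theory Defs
  imports
    "HOL-Analysis.Finite_Cartesian_Product"
    "HOL-Library.Poly_Mapping"
    "HOL-Library.Equipollence"
begin

section \<open>The polynomial ring\<close>

text \<open>
  The polynomial ring over \<open>'k\<close> in the variables indexed by the finite type \<open>'v\<close>; a monomial is
  its exponent vector. For the ring in \<open>x\<^sub>0, \<dots>, x\<^sub>n\<close> the type \<open>'v\<close> has \<open>n + 1\<close> elements.
\<close>

type_synonym ('v, 'k) mpoly = "('v \<Rightarrow>\<^sub>0 nat) \<Rightarrow>\<^sub>0 'k"

definition scalar :: "'k \<Rightarrow> ('v::finite, 'k::field) mpoly" where
  "scalar c = Poly_Mapping.single 0 c"

definition X :: "'v \<Rightarrow> ('v::finite, 'k::field) mpoly" where
  "X i = Poly_Mapping.single (Poly_Mapping.single i 1) 1"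

definition peval :: "('v::finite, 'k::field) mpoly \<Rightarrow> 'k ^ 'v \<Rightarrow> 'k" where
  "peval f x = (\<Sum>t\<in>Poly_Mapping.keys f.
     Poly_Mapping.lookup f t * (\<Prod>i\<in>UNIV. (x $ i) ^ Poly_Mapping.lookup t i))"

definition forms :: "nat \<Rightarrow> ('v::finite, 'k::field) mpoly set" where
  "forms d = {f. \<forall>t\<in>Poly_Mapping.keys f. (\<Sum>i\<in>UNIV. Poly_Mapping.lookup t i) = d}"

section \<open>Ideals and primary decomposition\<close>

definition is_ideal :: "'r::comm_ring_1 set \<Rightarrow> bool" where
  "is_ideal I \<longleftrightarrow> module.subspace (*) I"

definition ideal_gen :: "'r::comm_ring_1 set \<Rightarrow> 'r set" where
  "ideal_gen G = module.span (*) G"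

definition homogeneous_ideal :: "('v::finite, 'k::field) mpoly set \<Rightarrow> bool" where
  "homogeneous_ideal I \<longleftrightarrow> (\<exists>G \<subseteq> (\<Union>d. forms d). I = ideal_gen G)"

definition irrelevant_ideal :: "('v::finite, 'k::field) mpoly set" where
  "irrelevant_ideal = ideal_gen (range X)"

definition radical :: "'r::comm_ring_1 set \<Rightarrow> 'r set" where
  "radical I = {f. \<exists>n. f ^ n \<in> I}"

definition primary_ideal :: "'r::comm_ring_1 set \<Rightarrow> bool" where
  "primary_ideal Q \<longleftrightarrow> is_ideal Q \<and> Q \<noteq> UNIV \<and>
     (\<forall>f g. f * g \<in> Q \<longrightarrow> f \<in> Q \<or> g \<in> radical Q)"

definition minimal_primary_decomposition :: "'r::comm_ring_1 set \<Rightarrow> 'r set set \<Rightarrow> bool" where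
  "minimal_primary_decomposition I D \<longleftrightarrow>
     finite D \<and> (\<forall>Q\<in>D. primary_ideal Q) \<and> \<Inter>D = I \<and>
     inj_on radical D \<and> (\<forall>Q\<in>D. \<Inter>(D - {Q}) \<noteq> I)"

text \<open>
  The ideal \<open>I\<^sup>u\<close>. For homogeneous \<open>I\<close> it does not depend on the chosen decomposition, which
  exists by the Lasker-Noether theorem.
\<close>

definition unmixed_part :: "('v::finite, 'k::field) mpoly set \<Rightarrow> ('v, 'k) mpoly set" where
  "unmixed_part I =
     \<Inter>{Q \<in> (SOME D. minimal_primary_decomposition I D). radical Q \<noteq> irrelevant_ideal}"

section \<open>Graded pieces of the quotient ring\<close>

text \<open>
  Residue classes modulo \<open>I\<close> are handled through representatives, \<open>[f] = [g]\<close> being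
  \<open>f - g \<in> I\<close>. The graded piece \<open>R\<^sub>d\<close> of \<open>R = S/I\<close> consists of the classes of the forms of
  degree \<open>d\<close>; the predicate below says that the classes \<open>[b\<^sub>k]\<close>, \<open>k \<in> K\<close>, of forms of
  degree \<open>d\<close> are a basis of \<open>R\<^sub>d\<close> over the coefficient field.
\<close>

definition residue_basis ::
    "('v::finite, 'k::field) mpoly set \<Rightarrow> nat \<Rightarrow> 'i set \<Rightarrow> ('i \<Rightarrow> ('v, 'k) mpoly) \<Rightarrow> bool" where
  "residue_basis I d K b \<longleftrightarrow>
     (\<forall>k\<in>K. b k \<in> forms d) \<and>
     (\<forall>c. (\<Sum>k\<in>K. scalar (c k) * b k) \<in> I \<longrightarrow> (\<forall>k\<in>K. c k = 0)) \<and>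
     (\<forall>f\<in>forms d. \<exists>c. f - (\<Sum>k\<in>K. scalar (c k) * b k) \<in> I)"

definition dim_piece :: "('v::finite, 'k::field) mpoly set \<Rightarrow> nat \<Rightarrow> nat" where
  "dim_piece I d = (THE m. \<exists>b. residue_basis I d {..<m} b)"

definition proj_dim_zero :: "('v::finite, 'k::field) mpoly set \<Rightarrow> bool" where
  "proj_dim_zero I \<longleftrightarrow>
     homogeneous_ideal I \<and> (\<exists>m>0. \<exists>N. \<forall>i\<ge>N. dim_piece I i = m)"

text \<open>The numbers \<open>post(S/I)\<close> and \<open>nz(S/I)\<close>, as functions of \<open>I\<close>.\<close>

definition post :: "('v::finite, 'k::field) mpoly set \<Rightarrow> nat" where
  "post I = (LEAST i. \<forall>j\<ge>i. dim_piece I j = dim_piece I i)"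

definition nz :: "('v::finite, 'k::field) mpoly set \<Rightarrow> nat" where
  "nz I = max (post I) (post (unmixed_part I))"

section \<open>Projective points and common eigenvectors\<close>

text \<open>
  The point with homogeneous coordinates \<open>x \<noteq> 0\<close> is the set of all its coordinate vectors.
\<close>

definition proj_class :: "'k::field ^ 'i \<Rightarrow> ('k ^ 'i) set" where
  "proj_class x = {c *s x | c. c \<noteq> 0}"

definition proj_space :: "('k::field ^ 'i) set set" where
  "proj_space = {proj_class x | x. x \<noteq> 0}"

definition proj_zeros :: "('v::finite, 'k::field) mpoly set \<Rightarrow> ('k ^ 'v) set set" where
  "proj_zeros I =
     {P \<in> proj_space. \<forall>f \<in> I \<inter> (\<Union>d. forms d). \<forall>x\<in>P. peval f x = 0}"

definition value_vector :: "('m \<Rightarrow> ('v::finite, 'k::field) mpoly) \<Rightarrow> 'k ^ 'v \<Rightarrow> 'k ^ 'm" where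
  "value_vector e x = (\<chi> h. peval (e h) x)"

definition common_eigenvector :: "('j \<Rightarrow> 'k::field ^ 'm ^ 'm) \<Rightarrow> 'k ^ 'm \<Rightarrow> bool" where
  "common_eigenvector A v \<longleftrightarrow> v \<noteq> 0 \<and> (\<forall>j. \<exists>c. A j *v v = c *s v)"

end

theory Submission
  imports Defs "HOL-Analysis.Cartesian_Space"
begin

text \<open>
  Write \<open>d = nz(R)\<close>. The relations \<open>[x\<^sub>j e\<^sub>k] = \<Sum>\<^sub>h (A\<^sub>j)\<^sub>k\<^sub>h [e\<^sub>h l]\<close> show that the classes
  \<open>[e\<^sub>k l\<^sup>s]\<close> span \<open>R\<^sub>d\<^sub>+\<^sub>s\<close> for all \<open>s\<close>; as \<open>d \<ge> post(R)\<close>, the dimension is constantly \<open>m\<close>, so they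
  form a basis, and multiplication by \<open>x\<^sub>j\<close> from \<open>R\<^sub>d\<^sub>+\<^sub>s\<close> to \<open>R\<^sub>d\<^sub>+\<^sub>s\<^sub>+\<^sub>1\<close> has the matrix \<open>A\<^sub>j\<close> for every \<open>s\<close>.

  Evaluating the relations at a zero \<open>p\<close> of \<open>I\<close> shows that \<open>(e\<^sub>k(p))\<^sub>k\<close> is a common eigenvector with
  eigenvalues \<open>x\<^sub>j(p) / l(p)\<close>; in particular the eigenvalues determine \<open>p\<close>.
  Conversely, let \<open>v\<close> be a common eigenvector with eigenvalues \<open>\<lambda>\<^sub>j\<close>. For a form \<open>f\<close> of degree \<open>s\<close>, expand
  \<open>f l\<^sup>d = \<Sum>\<^sub>k c\<^sub>k e\<^sub>k l\<^sup>s\<close> modulo \<open>I\<close> and put \<open>\<Phi>(f) = \<Sum>\<^sub>k c\<^sub>k v\<^sub>k\<close>. Then \<open>\<Phi>(x\<^sub>j f) = \<lambda>\<^sub>j \<Phi>(f)\<close>, hence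
  \<open>\<Phi>(f) = C f(\<lambda>)\<close> with \<open>C = \<Phi>(1)\<close>. Since \<open>\<Phi>\<close> vanishes on \<open>I\<close> and \<open>\<Phi>(e\<^sub>k) = v\<^sub>k\<close>, the point \<open>\<lambda>\<close> is a zero of \<open>I\<close>
  and \<open>v\<close> is a multiple of \<open>(e\<^sub>k(\<lambda>))\<^sub>k\<close>. Finiteness follows because common eigenvectors with
  distinct eigenvalue tuples are linearly independent.
\<close>

section \<open>Ideals, evaluation and forms\<close>

lemma is_idealD:
  assumes "is_ideal I"
  shows ideal_zero: "0 \<in> I"
    and ideal_add: "\<And>f g. f \<in> I \<Longrightarrow> g \<in> I \<Longrightarrow> f + g \<in> I"
    and ideal_mult: "\<And>f g. g \<in> I \<Longrightarrow> f * g \<in> I"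
proof -
  have "module ((*) :: 'a \<Rightarrow> 'a \<Rightarrow> 'a)"
    by unfold_locales (simp_all add: algebra_simps)
  with assms show "0 \<in> I"
    and "\<And>f g. f \<in> I \<Longrightarrow> g \<in> I \<Longrightarrow> f + g \<in> I"
    and "\<And>f g. g \<in> I \<Longrightarrow> f * g \<in> I"
    by (auto simp: is_ideal_def module.subspace_def)
qed

lemma ideal_diff: "is_ideal I \<Longrightarrow> f \<in> I \<Longrightarrow> g \<in> I \<Longrightarrow> f - g \<in> I"
  using ideal_add[of I f "(- 1) * g"] ideal_mult[of I g "- 1"] by simp

lemma ideal_sum: "is_ideal I \<Longrightarrow> (\<And>x. x \<in> B \<Longrightarrow> f x \<in> I) \<Longrightarrow> sum f B \<in> I"
  by (induction B rule: infinite_finite_induct) (auto intro: ideal_zero ideal_add)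

lemma scalar_0 [simp]: "scalar 0 = 0"
  by (simp add: scalar_def)

lemma scalar_1 [simp]: "scalar 1 = 1"
  by (simp add: scalar_def)

lemma scalar_add: "scalar (a + b) = scalar a + scalar b"
  by (simp add: scalar_def single_add)

lemma scalar_diff: "scalar (a - b) = scalar a - scalar b"
  by (simp add: scalar_def single_diff)

lemma scalar_mult: "scalar (a * b) = scalar a * scalar b"
  by (simp add: scalar_def mult_single)

lemma scalar_sum: "scalar (sum f B) = (\<Sum>x\<in>B. scalar (f x))"
  by (induction B rule: infinite_finite_induct) (auto simp: scalar_add)

text \<open>Summing over any finite set that contains the support lets \<open>f\<close>,
  \<open>g\<close> and \<open>f + g\<close> be evaluated over one common index set.\<close>

lemma peval_superset:
  assumes "finite B" "Poly_Mapping.keys f \<subseteq> B"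
  shows "peval f x = (\<Sum>t\<in>B. Poly_Mapping.lookup f t * (\<Prod>i\<in>UNIV. (x $ i) ^ Poly_Mapping.lookup t i))"
  unfolding peval_def using assms
  by (intro sum.mono_neutral_left) (auto simp: in_keys_iff)

lemma peval_0 [simp]: "peval 0 x = 0"
  by (simp add: peval_def)

lemma peval_add: "peval (f + g) x = peval f x + peval g x"
proof -
  let ?B = "Poly_Mapping.keys f \<union> Poly_Mapping.keys g"
  have "Poly_Mapping.keys (f + g) \<subseteq> ?B"
    by (rule Poly_Mapping.keys_add)
  then show ?thesis
    by (simp add: peval_superset[of ?B] lookup_add sum.distrib distrib_right)
qed

lemma peval_sum: "peval (sum f B) x = (\<Sum>b\<in>B. peval (f b) x)"
  by (induction B rule: infinite_finite_induct) (auto simp: peval_add)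

lemma peval_single:
  "peval (Poly_Mapping.single t c) x = c * (\<Prod>i\<in>UNIV. (x $ i) ^ Poly_Mapping.lookup t i)"
  by (subst peval_superset[of "{t}"]) auto

lemma peval_scalar [simp]: "peval (scalar c) x = c"
  by (simp add: scalar_def peval_single)

lemma peval_1 [simp]: "peval 1 x = 1"
  using peval_scalar[of 1 x] by simp

lemma peval_X [simp]: "peval (X i) x = x $ i"
proof -
  have "(\<Prod>j\<in>UNIV. (x $ j) ^ Poly_Mapping.lookup (Poly_Mapping.single i (1::nat)) j)
      = (\<Prod>j\<in>UNIV. if j = i then x $ j else 1)"
    by (intro prod.cong) (auto simp: lookup_single when_def)
  then show ?thesis
    by (simp add: X_def peval_single)
qed

lemma sum_single_keys: "f = (\<Sum>t\<in>Poly_Mapping.keys f. Poly_Mapping.single t (Poly_Mapping.lookup f t))"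
  by (rule poly_mapping_eqI)
     (simp add: lookup_sum lookup_single when_def in_keys_iff sum.delta')

text \<open>By bilinearity it suffices to treat two monomials, where exponents add.\<close>

lemma peval_mult: "peval (f * g) x = peval f x * peval g x"
proof -
  have single: "peval (Poly_Mapping.single s a * Poly_Mapping.single t b) x =
      peval (Poly_Mapping.single s a) x * peval (Poly_Mapping.single t b) x" for s t a b
    by (simp add: mult_single peval_single lookup_add power_add prod.distrib)
  let ?s = "\<lambda>f t. Poly_Mapping.single t (Poly_Mapping.lookup f t)"
  have "peval (f * g) x =
      peval ((\<Sum>s\<in>Poly_Mapping.keys f. ?s f s) * (\<Sum>t\<in>Poly_Mapping.keys g. ?s g t)) x"
    by (simp flip: sum_single_keys)
  also have "\<dots> = peval (\<Sum>s\<in>Poly_Mapping.keys f. ?s f s) x * peval (\<Sum>t\<in>Poly_Mapping.keys g. ?s g t) x"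
    by (simp add: sum_product peval_sum single)
  finally show ?thesis
    by (simp flip: sum_single_keys)
qed

lemma peval_diff: "peval (f - g) x = peval f x - peval g x"
  using peval_add[of "f - g" g x] by simp

lemma peval_power: "peval (f ^ n) x = peval f x ^ n"
  by (induction n) (simp_all add: peval_mult)

section \<open>Homogeneous polynomials and induction on the degree\<close>

lemma forms_0 [simp]: "0 \<in> forms d"
  by (simp add: forms_def)

lemma forms_add: "f \<in> forms d \<Longrightarrow> g \<in> forms d \<Longrightarrow> f + g \<in> forms d"
  using Poly_Mapping.keys_add[of f g] by (force simp: forms_def)

lemma forms_diff: "f \<in> forms d \<Longrightarrow> g \<in> forms d \<Longrightarrow> f - g \<in> forms d"
  using keys_diff[of f g] by (force simp: forms_def)

lemma forms_sum: "(\<And>x. x \<in> B \<Longrightarrow> f x \<in> forms d) \<Longrightarrow> sum f B \<in> forms d"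
  by (induction B rule: infinite_finite_induct) (auto intro: forms_add)

lemma forms_mult: "f \<in> forms a \<Longrightarrow> g \<in> forms b \<Longrightarrow> f * g \<in> forms (a + b)"
  using keys_mult[of f g] by (fastforce simp: forms_def lookup_add sum.distrib)

lemma scalar_forms: "scalar c \<in> forms 0"
  by (auto simp: forms_def scalar_def split: if_splits)

lemma forms_scalar_mult: "f \<in> forms d \<Longrightarrow> scalar c * f \<in> forms d"
  using forms_mult[OF scalar_forms] by fastforce

lemma X_forms: "X i \<in> forms 1"
  by (simp add: forms_def X_def lookup_single when_def)

lemma forms_power: "f \<in> forms a \<Longrightarrow> f ^ n \<in> forms (n * a)"
proof (induction n)
  case 0
  then show ?case using scalar_forms[of 1] by simp
next
  case (Suc n)
  then show ?case using forms_mult[of f a "f ^ n"] by simp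
qed

lemma forms_0_scalar:
  assumes "f \<in> forms 0"
  obtains c where "f = scalar c"
proof
  have "t = 0" if "t \<in> Poly_Mapping.keys f" for t
  proof (rule poly_mapping_eqI)
    show "Poly_Mapping.lookup t i = Poly_Mapping.lookup 0 i" for i
      using assms that by (auto simp: forms_def)
  qed
  then show "f = scalar (Poly_Mapping.lookup f 0)"
    by (intro poly_mapping_eqI) (force simp: scalar_def lookup_single when_def in_keys_iff)
qed

text \<open>A monomial of positive degree is divisible by some variable, and splitting that variable
  off works term by term. This drives both inductions on the degree below.\<close>

lemma forms_Suc_decompose:
  assumes "f \<in> forms (Suc d)"
  shows "\<exists>g. (\<forall>j. g j \<in> forms d) \<and> f = (\<Sum>j\<in>UNIV. X j * g j)"
proof -
  have single: "\<exists>g. (\<forall>j. g j \<in> forms d) \<and>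
      Poly_Mapping.single t (Poly_Mapping.lookup f t) = (\<Sum>j\<in>UNIV. X j * g j)"
    if "t \<in> Poly_Mapping.keys f" for t
  proof -
    have deg: "(\<Sum>i\<in>UNIV. Poly_Mapping.lookup t i) = Suc d"
      using assms that by (auto simp: forms_def)
    then obtain j where j: "Poly_Mapping.lookup t j \<noteq> 0"
      by (metis Zero_not_Suc sum.neutral)
    \<comment> \<open>The truncated subtraction of exponents is exact here because the exponent at
      \<open>j\<close> is positive.\<close>
    have "t = Poly_Mapping.single j 1 + (t - Poly_Mapping.single j 1)"
      using j by (intro poly_mapping_eqI) (auto simp: lookup_add lookup_minus lookup_single when_def)
    then obtain u where t: "t = Poly_Mapping.single j 1 + u" ..
    let ?g = "\<lambda>i. if i = j then Poly_Mapping.single u (Poly_Mapping.lookup f t) else 0"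
    have "(\<Sum>i\<in>UNIV. Poly_Mapping.lookup u i) = d"
      using deg unfolding t by (simp add: lookup_add sum.distrib lookup_single when_def)
    then have "\<forall>i. ?g i \<in> forms d"
      by (auto simp: forms_def)
    moreover have "(\<Sum>i\<in>UNIV. X i * ?g i) = X j * Poly_Mapping.single u (Poly_Mapping.lookup f t)"
      by (simp add: if_distrib[of "\<lambda>y. _ * y"] cong: if_cong)
    moreover have "\<dots> = Poly_Mapping.single t (Poly_Mapping.lookup f t)"
      by (simp add: X_def mult_single t)
    ultimately have "(\<forall>i. ?g i \<in> forms d) \<and>
        Poly_Mapping.single t (Poly_Mapping.lookup f t) = (\<Sum>i\<in>UNIV. X i * ?g i)"
      by simp
    then show ?thesis
      by (rule exI[of _ ?g])
  qed
  then have "\<forall>t\<in>Poly_Mapping.keys f. \<exists>g. (\<forall>j. g j \<in> forms d) \<and>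
      Poly_Mapping.single t (Poly_Mapping.lookup f t) = (\<Sum>j\<in>UNIV. X j * g j)"
    by blast
  from bchoice[OF this] obtain g where g: "\<And>t j. t \<in> Poly_Mapping.keys f \<Longrightarrow> g t j \<in> forms d"
    "\<And>t. t \<in> Poly_Mapping.keys f \<Longrightarrow>
      Poly_Mapping.single t (Poly_Mapping.lookup f t) = (\<Sum>j\<in>UNIV. X j * g t j)"
    by blast
  show ?thesis
  proof (intro exI conjI allI)
    show "(\<Sum>t\<in>Poly_Mapping.keys f. g t j) \<in> forms d" for j
      using g(1) by (rule forms_sum)
    have "f = (\<Sum>t\<in>Poly_Mapping.keys f. Poly_Mapping.single t (Poly_Mapping.lookup f t))"
      by (rule sum_single_keys)
    also have "\<dots> = (\<Sum>t\<in>Poly_Mapping.keys f. \<Sum>j\<in>UNIV. X j * g t j)"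
      by (intro sum.cong refl g(2))
    finally show "f = (\<Sum>j\<in>UNIV. X j * (\<Sum>t\<in>Poly_Mapping.keys f. g t j))"
      by (subst (asm) sum.swap) (simp only: sum_distrib_left)
  qed
qed

lemma peval_forms_scale:
  assumes "f \<in> forms d"
  shows "peval f (c *s x) = c ^ d * peval f x"
proof -
  have "(\<Prod>i\<in>UNIV. ((c *s x) $ i) ^ Poly_Mapping.lookup t i) =
      c ^ d * (\<Prod>i\<in>UNIV. (x $ i) ^ Poly_Mapping.lookup t i)"
    if "t \<in> Poly_Mapping.keys f" for t
    using assms that by (auto simp: forms_def power_mult_distrib prod.distrib power_sum)
  then show ?thesis
    unfolding peval_def by (auto simp: sum_distrib_left mult_ac intro!: sum.cong)
qed

section \<open>Bases of graded pieces\<close>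

text \<open>Gaussian elimination for a homogeneous system with equations indexed by \<open>K\<close>
  and unknowns by \<open>L\<close>: one equation is used to remove one unknown. It supplies every
  dimension count below.\<close>

lemma nontrivial_solution:
  fixes a :: "'l \<Rightarrow> 'i \<Rightarrow> 'k::field"
  assumes "finite K" "finite L" "card K < card L"
  shows "\<exists>c. (\<exists>x\<in>L. c x \<noteq> 0) \<and> (\<forall>k\<in>K. (\<Sum>x\<in>L. c x * a x k) = 0)"
  using assms
proof (induction K arbitrary: L a rule: finite_induct)
  case empty
  then have "L \<noteq> {}" by auto
  then show ?case by (intro exI[of _ "\<lambda>_. 1"]) auto
next
  case (insert q K)
  show ?case
  proof (cases "\<forall>x\<in>L. a x q = 0")
    case True
    have "\<exists>c. (\<exists>x\<in>L. c x \<noteq> 0) \<and> (\<forall>k\<in>K. (\<Sum>x\<in>L. c x * a x k) = 0)"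
      using insert by auto
    with True show ?thesis by auto
  next
    case False
    then obtain y where y: "y \<in> L" "a y q \<noteq> 0" by blast
    let ?L = "L - {y}"
    have "card K < card ?L"
      using insert y by (simp add: card_Diff_singleton)
    \<comment> \<open>These are the coefficients left after equation \<open>q\<close> has been
      solved for the unknown \<open>y\<close> and substituted.\<close>
    from insert.IH[OF _ this, of "\<lambda>x k. a x k - a x q / a y q * a y k"]
    obtain c where c: "\<exists>x\<in>?L. c x \<noteq> 0"
      "\<And>k. k \<in> K \<Longrightarrow> (\<Sum>x\<in>?L. c x * (a x k - a x q / a y q * a y k)) = 0"
      using insert.prems by auto
    \<comment> \<open>Back substitution: the value at \<open>y\<close> is the one that equation
      \<open>q\<close> dictates.\<close>
    define c' where "c' = c(y := - (\<Sum>x\<in>?L. c x * a x q) / a y q)"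
    have split: "(\<Sum>x\<in>L. c' x * a x k) =
        (\<Sum>x\<in>?L. c x * a x k) - (\<Sum>x\<in>?L. c x * a x q) / a y q * a y k" for k
      using insert.prems y
      by (subst sum.remove[of _ y]) (auto simp: c'_def intro!: sum.cong)
    have "(\<Sum>x\<in>L. c' x * a x k) = 0" if "k \<in> insert q K" for k
    proof (cases "k = q")
      case True
      then show ?thesis using y by (simp add: split)
    next
      case False
      with that c(2)[of k] have "(\<Sum>x\<in>?L. c x * a x k - c x * a x q / a y q * a y k) = 0"
        by (simp add: algebra_simps)
      then show ?thesis
        by (simp add: split sum_subtractf sum_distrib_right sum_divide_distrib)
    qed
    moreover have "\<exists>x\<in>L. c' x \<noteq> 0"
      using c(1) by (auto simp: c'_def)
    ultimately show ?thesis by blast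
  qed
qed


section \<open>Coordinates modulo an ideal\<close>

abbreviation (input) lincomb :: "'i set \<Rightarrow> ('i \<Rightarrow> 'k) \<Rightarrow> ('i \<Rightarrow> ('v::finite, 'k::field) mpoly) \<Rightarrow> ('v, 'k) mpoly" where
  "lincomb K c b \<equiv> (\<Sum>k\<in>K. scalar (c k) * b k)"

lemma lincomb_diff: "lincomb K (\<lambda>k. c k - c' k) b = lincomb K c b - lincomb K c' b"
  by (simp add: scalar_diff left_diff_distrib sum_subtractf)

lemma sum_lincomb:
  "(\<Sum>x\<in>L. scalar (a x) * lincomb K (c x) b) = lincomb K (\<lambda>k. \<Sum>x\<in>L. a x * c x k) b"
  by (simp add: scalar_sum scalar_mult sum_distrib_left sum_distrib_right mult.assoc) (rule sum.swap)

lemma coords_sum: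
  assumes "is_ideal I" "\<And>x. x \<in> L \<Longrightarrow> f x - lincomb K (c x) b \<in> I"
  shows "(\<Sum>x\<in>L. scalar (a x) * f x) - lincomb K (\<lambda>k. \<Sum>x\<in>L. a x * c x k) b \<in> I"
proof -
  have "(\<Sum>x\<in>L. scalar (a x) * (f x - lincomb K (c x) b)) \<in> I"
    using assms by (intro ideal_sum ideal_mult) auto
  then show ?thesis
    by (simp only: right_diff_distrib sum_subtractf sum_lincomb)
qed

lemma residue_basis_forms: "residue_basis I d K b \<Longrightarrow> k \<in> K \<Longrightarrow> b k \<in> forms d"
  by (simp add: residue_basis_def)

lemma residue_basis_indep:
  "residue_basis I d K b \<Longrightarrow> lincomb K c b \<in> I \<Longrightarrow> k \<in> K \<Longrightarrow> c k = 0"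
  by (simp add: residue_basis_def)

lemma residue_basis_span:
  "residue_basis I d K b \<Longrightarrow> f \<in> forms d \<Longrightarrow> \<exists>c. f - lincomb K c b \<in> I"
  by (simp add: residue_basis_def)

lemma coords_unique:
  assumes "is_ideal I" "residue_basis I d K b"
    and "f - lincomb K c b \<in> I" "f - lincomb K c' b \<in> I" "k \<in> K"
  shows "c k = c' k"
proof -
  have "(f - lincomb K c' b) - (f - lincomb K c b) \<in> I"
    by (rule ideal_diff[OF assms(1,4,3)])
  then have "lincomb K (\<lambda>k. c k - c' k) b \<in> I"
    by (simp add: lincomb_diff)
  from residue_basis_indep[OF assms(2) this assms(5)] have "c k - c' k = 0" .
  then show ?thesis by simp
qed

text \<open>If \<open>L\<close> were larger, the coordinate vectors of the \<open>b' x\<close> would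
  satisfy a nontrivial linear relation, and this would be a relation of the \<open>b' x\<close>
  modulo \<open>I\<close>.\<close>

lemma residue_basis_card_le:
  assumes "is_ideal I" "residue_basis I d K b" "residue_basis I d L b'" "finite K" "finite L"
  shows "card L \<le> card K"
proof (rule ccontr)
  assume "\<not> card L \<le> card K"
  have "\<forall>x\<in>L. \<exists>a. b' x - lincomb K a b \<in> I"
    using residue_basis_span[OF assms(2)] residue_basis_forms[OF assms(3)] by blast
  then obtain a where a: "\<And>x. x \<in> L \<Longrightarrow> b' x - lincomb K (a x) b \<in> I"
    by metis
  obtain c where c: "\<exists>x\<in>L. c x \<noteq> 0" "\<forall>k\<in>K. (\<Sum>x\<in>L. c x * a x k) = 0"
    using nontrivial_solution[of K L a] assms \<open>\<not> card L \<le> card K\<close> by auto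
  have "lincomb K (\<lambda>k. \<Sum>x\<in>L. c x * a x k) b = 0"
    using c(2) by (intro sum.neutral) auto
  with coords_sum[where I = I and L = L and f = b' and K = K and c = a and b = b and a = c] assms(1) a have "lincomb L c b' \<in> I"
    by simp
  from residue_basis_indep[OF assms(3) this] c(1) show False
    by blast
qed

lemma residue_basis_reindex:
  assumes "bij_betw \<pi> L K" "residue_basis I d K b"
  shows "residue_basis I d L (b \<circ> \<pi>)"
proof -
  have eq: "lincomb L (c \<circ> \<pi>) (b \<circ> \<pi>) = lincomb K c b" for c
    using sum.reindex_bij_betw[OF assms(1), of "\<lambda>k. scalar (c k) * b k"] by (simp add: o_def)
  have eq': "lincomb L c (b \<circ> \<pi>) = lincomb K (c \<circ> inv_into L \<pi>) b" for c
    unfolding eq[symmetric] using assms(1)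
    by (intro sum.cong) (auto simp: bij_betw_def)
  have "c k = 0" if "lincomb L c (b \<circ> \<pi>) \<in> I" "k \<in> L" for c k
  proof -
    have "\<pi> k \<in> K"
      using assms(1) that(2) by (auto simp: bij_betw_def)
    from residue_basis_indep[OF assms(2) that(1)[unfolded eq'] this]
    have "(c \<circ> inv_into L \<pi>) (\<pi> k) = 0" .
    then show "c k = 0"
      using that(2) assms(1) by (simp add: bij_betw_def)
  qed
  moreover have "\<exists>c. f - lincomb L c (b \<circ> \<pi>) \<in> I" if "f \<in> forms d" for f
  proof -
    obtain c where "f - lincomb K c b \<in> I"
      using residue_basis_span[OF assms(2) \<open>f \<in> forms d\<close>] by blast
    then have "f - lincomb L (c \<circ> \<pi>) (b \<circ> \<pi>) \<in> I"
      unfolding eq .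
    then show ?thesis
      by (rule exI[of _ "c \<circ> \<pi>"])
  qed
  moreover have "(b \<circ> \<pi>) k \<in> forms d" if "k \<in> L" for k
    using residue_basis_forms[OF assms(2)] assms(1) that by (auto simp: bij_betw_def)
  ultimately show ?thesis
    by (simp add: residue_basis_def)
qed

text \<open>A definite description has a known value only after existence and uniqueness are shown:
  reindexing by an initial segment gives the first, comparing cardinalities in both directions the
  second.\<close>

lemma dim_piece_eq:
  assumes "is_ideal I" "residue_basis I d K b" "finite K"
  shows "dim_piece I d = card K"
  unfolding dim_piece_def
proof (rule the_equality)
  obtain \<pi> where "bij_betw \<pi> {..<card K} K"
    using ex_bij_betw_nat_finite[OF assms(3)] by (auto simp: atLeast0LessThan)
  then show "\<exists>b. residue_basis I d {..<card K} b"
    using residue_basis_reindex assms(2) by blast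
next
  fix m :: nat assume "\<exists>b. residue_basis I d {..<m} b"
  then obtain b' where "residue_basis I d {..<m} b'" ..
  then show "m = card K"
    using residue_basis_card_le[OF assms(1)] assms(2,3)
    by (metis card_lessThan finite_lessThan order_antisym)
qed

text \<open>As long as there is a nontrivial relation, an element occurring in it can be discarded
  without losing the span.\<close>

lemma spanning_contains_basis:
  assumes "is_ideal I" "finite K" "\<And>k. k \<in> K \<Longrightarrow> b k \<in> forms d"
    and "\<And>f. f \<in> forms d \<Longrightarrow> \<exists>c. f - lincomb K c b \<in> I"
  shows "\<exists>T\<subseteq>K. residue_basis I d T b"
  using assms(2-4)
proof (induction K rule: finite_psubset_induct)
  case (psubset K)
  show ?case
  proof (cases "\<exists>c. lincomb K c b \<in> I \<and> (\<exists>y\<in>K. c y \<noteq> 0)")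
    case False
    then have "residue_basis I d K b"
      using psubset.prems by (simp add: residue_basis_def)
    then show ?thesis by blast
  next
    case True
    then obtain c y where c: "lincomb K c b \<in> I" "y \<in> K" "c y \<noteq> 0" by blast
    have "\<exists>a. f - lincomb (K - {y}) a b \<in> I" if f: "f \<in> forms d" for f
    proof -
      obtain a where a: "f - lincomb K a b \<in> I"
        using psubset.prems(2)[OF f] by blast
      \<comment> \<open>This multiple of the relation cancels the coefficient at
        \<open>y\<close>.\<close>
      let ?q = "a y / c y"
      have "(f - lincomb K a b) + scalar ?q * lincomb K c b \<in> I"
        using a c(1) assms(1) by (intro ideal_add ideal_mult)
      moreover have "scalar ?q * lincomb K c b = lincomb K (\<lambda>k. ?q * c k) b"
        by (simp add: scalar_mult sum_distrib_left mult.assoc del: times_divide_eq_left)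
      ultimately have "f - lincomb K (\<lambda>k. a k - ?q * c k) b \<in> I"
        by (simp only: lincomb_diff diff_diff_eq2 diff_add_eq)
      moreover have "lincomb K (\<lambda>k. a k - ?q * c k) b = lincomb (K - {y}) (\<lambda>k. a k - ?q * c k) b"
        using c psubset.hyps by (subst sum.remove[of _ y]) auto
      ultimately show ?thesis by auto
    qed
    then have "\<exists>T\<subseteq>K - {y}. residue_basis I d T b"
      using psubset.prems(1) c(2) by (intro psubset.IH) auto
    then show ?thesis by blast
  qed
qed

text \<open>Multiplication by \<open>X j\<close> acts on coordinate rows as right multiplication by
  \<open>A j\<close>. The same matrices serve for every \<open>s\<close>, since the relations
  \<open>mult\<close> may be multiplied by \<open>l ^ s\<close>.\<close>

lemma coords_step:
  fixes e :: "'m::finite \<Rightarrow> ('v::finite, 'k::field) mpoly" and A :: "'v \<Rightarrow> 'k ^ 'm ^ 'm"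
  assumes "is_ideal I"
    and mult: "\<And>j k. X j * e k - (\<Sum>h\<in>UNIV. scalar (A j $ k $ h) * (e h * l)) \<in> I"
    and g: "\<And>j. g j - lincomb UNIV (c j) (\<lambda>k. e k * l ^ s) \<in> I"
  shows "(\<Sum>j\<in>UNIV. X j * g j) -
    lincomb UNIV (\<lambda>h. \<Sum>j\<in>UNIV. \<Sum>k\<in>UNIV. c j k * A j $ k $ h) (\<lambda>k. e k * l ^ Suc s) \<in> I"
proof -
  have step: "X j * g j -
      lincomb UNIV (\<lambda>h. \<Sum>k\<in>UNIV. c j k * A j $ k $ h) (\<lambda>k. e k * l ^ Suc s) \<in> I" for j
  proof -
    have "X j * (e k * l ^ s) - lincomb UNIV (\<lambda>h. A j $ k $ h) (\<lambda>k. e k * l ^ Suc s) \<in> I" for k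
      using ideal_mult[OF assms(1) mult[of j k], of "l ^ s"]
      by (simp add: right_diff_distrib sum_distrib_left mult_ac)
    then have "(\<Sum>k\<in>UNIV. scalar (c j k) * (X j * (e k * l ^ s))) -
        lincomb UNIV (\<lambda>h. \<Sum>k\<in>UNIV. c j k * A j $ k $ h) (\<lambda>k. e k * l ^ Suc s) \<in> I"
      by (intro coords_sum assms(1))
    moreover have "X j * (g j - lincomb UNIV (c j) (\<lambda>k. e k * l ^ s)) \<in> I"
      by (intro ideal_mult assms(1) g)
    ultimately show ?thesis
      using ideal_add[OF assms(1)] by (force simp: right_diff_distrib sum_distrib_left mult_ac)
  qed
  show ?thesis
    using coords_sum[where a = "\<lambda>_. 1", OF assms(1) step] by simp
qed

text \<open>Spanning follows by induction on \<open>s\<close>, independence from a dimension count: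
  a basis contained in the spanning family must already have \<open>CARD('m)\<close>
  members.\<close>

lemma residue_basis_shift:
  fixes e :: "'m::finite \<Rightarrow> ('v::finite, 'k::field) mpoly" and A :: "'v \<Rightarrow> 'k ^ 'm ^ 'm"
  assumes I: "is_ideal I"
    and e: "residue_basis I d UNIV e"
    and l: "l \<in> forms 1"
    and mult: "\<And>j k. X j * e k - (\<Sum>h\<in>UNIV. scalar (A j $ k $ h) * (e h * l)) \<in> I"
    and dim: "\<And>i. i \<ge> d \<Longrightarrow> dim_piece I i = dim_piece I d"
  shows "residue_basis I (d + s) UNIV (\<lambda>k. e k * l ^ s)"
proof -
  have span: "\<exists>c. f - lincomb UNIV c (\<lambda>k. e k * l ^ s) \<in> I" if "f \<in> forms (d + s)" for f
    using that
  proof (induction s arbitrary: f)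
    case 0
    then show ?case using e by (simp add: residue_basis_def)
  next
    case (Suc s)
    have "f \<in> forms (Suc (d + s))"
      using Suc.prems by simp
    then obtain g where g: "\<And>j. g j \<in> forms (d + s)" "f = (\<Sum>j\<in>UNIV. X j * g j)"
      using forms_Suc_decompose[of f "d + s"] by blast
    have "\<forall>j. \<exists>c. g j - lincomb UNIV c (\<lambda>k. e k * l ^ s) \<in> I"
      by (intro allI Suc.IH g(1))
    from choice[OF this] obtain c where c: "\<And>j. g j - lincomb UNIV (c j) (\<lambda>k. e k * l ^ s) \<in> I"
      by blast
    show ?case
      unfolding g(2) by (rule exI, rule coords_step[where g = g and c = c, OF I mult c])
  qed
  have "e k * l ^ s \<in> forms (d + s)" for k
    using forms_mult[of "e k" d "l ^ s" s] forms_power[OF l, of s] e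
    by (simp add: residue_basis_def)
  then obtain T where T: "residue_basis I (d + s) T (\<lambda>k. e k * l ^ s)"
    using spanning_contains_basis[of I UNIV "\<lambda>k. e k * l ^ s" "d + s"] I span by auto
  have "card T = CARD('m)"
    using dim_piece_eq[OF I T] dim_piece_eq[OF I e] dim[of "d + s"] by simp
  then have "T = UNIV"
    by (simp add: card_eq_UNIV_imp_eq_UNIV)
  with T show ?thesis by simp
qed

text \<open>Eventual constancy provides a witness for the \<open>LEAST\<close> in
  \<open>post\<close>, which therefore has its defining property.\<close>

lemma dim_piece_const:
  assumes "proj_dim_zero I" "post I \<le> d" "d \<le> i"
  shows "dim_piece I i = dim_piece I d"
proof -
  obtain m N where "\<forall>i\<ge>N. dim_piece I i = m"
    using assms(1) by (auto simp: proj_dim_zero_def)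
  then have "\<forall>j\<ge>N. dim_piece I j = dim_piece I N"
    by simp
  then have "\<forall>j\<ge>post I. dim_piece I j = dim_piece I (post I)"
    unfolding post_def by (rule LeastI)
  with assms(2,3) show ?thesis
    by (metis order_trans)
qed

section \<open>Common eigenvectors and projective zeros\<close>

text \<open>The sum over \<open>k\<close> is \<Phi>(f). Quantifying over all coordinate tuples
  \<open>c\<close> avoids choosing one to define \<Phi>. The factor \<open>l ^ d\<close> moves a
  form of any degree \<open>s\<close>, small ones included, to degree \<open>d + s\<close>, where a
  basis is known.\<close>

lemma eigenfunctional:
  fixes e :: "'m::finite \<Rightarrow> ('v::finite, 'k::field) mpoly" and A :: "'v \<Rightarrow> 'k ^ 'm ^ 'm"
  assumes I: "is_ideal I"
    and basis: "\<And>s. residue_basis I (d + s) UNIV (\<lambda>k. e k * l ^ s)"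
    and l: "l \<in> forms 1"
    and mult: "\<And>j k. X j * e k - (\<Sum>h\<in>UNIV. scalar (A j $ k $ h) * (e h * l)) \<in> I"
    and eigen: "\<And>j. A j *v v = (ev $ j) *s v"
  shows "\<exists>C. \<forall>s. \<forall>f \<in> forms s. \<forall>c.
    f * l ^ d - lincomb UNIV c (\<lambda>k. e k * l ^ s) \<in> I \<longrightarrow>
    (\<Sum>k\<in>UNIV. c k * v $ k) = C * peval f ev"
proof -
  have l_power: "l ^ d \<in> forms d"
    using forms_power[OF l, of d] by simp
  have e: "residue_basis I d UNIV e"
    using basis[of 0] by simp
  \<comment> \<open>These are the coordinates belonging to the form 1, so pairing them with
    \<open>v\<close> gives the constant \<Phi>(1).\<close>
  then obtain c0 where c0: "l ^ d - lincomb UNIV c0 e \<in> I"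
    using residue_basis_span[OF e l_power] by blast
  show ?thesis
  proof (intro exI allI ballI impI)
    fix s f c
    assume "f \<in> forms s" "f * l ^ d - lincomb UNIV c (\<lambda>k. e k * l ^ s) \<in> I"
    then show "(\<Sum>k\<in>UNIV. c k * v $ k) = (\<Sum>k\<in>UNIV. c0 k * v $ k) * peval f ev"
    proof (induction s arbitrary: f c)
      case 0
      then obtain a where a: "f = scalar a"
        by (auto elim: forms_0_scalar)
      have "f * l ^ d - lincomb UNIV (\<lambda>k. a * c0 k) e \<in> I"
        using ideal_mult[OF I c0, of f]
        by (simp add: a right_diff_distrib sum_distrib_left scalar_mult mult.assoc)
      then have "c k = a * c0 k" for k
        using coords_unique[OF I e, of "f * l ^ d" c] 0 by simp
      then show ?case
        by (simp add: a sum_distrib_left mult_ac)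
    next
      case (Suc s)
      obtain g where g: "\<And>j. g j \<in> forms s" "f = (\<Sum>j\<in>UNIV. X j * g j)"
        using forms_Suc_decompose[OF Suc.prems(1)] by blast
      have "g j * l ^ d \<in> forms (d + s)" for j
        using forms_mult[OF g(1)[of j] l_power] by (simp add: add.commute)
      then have "\<forall>j. \<exists>a. g j * l ^ d - lincomb UNIV a (\<lambda>k. e k * l ^ s) \<in> I"
        by (intro allI residue_basis_span[OF basis[of s]])
      from choice[OF this] obtain a
        where a: "\<And>j. g j * l ^ d - lincomb UNIV (a j) (\<lambda>k. e k * l ^ s) \<in> I"
        by blast
      let ?c = "\<lambda>h. \<Sum>j\<in>UNIV. \<Sum>k\<in>UNIV. a j k * A j $ k $ h"
      have "f * l ^ d - lincomb UNIV ?c (\<lambda>k. e k * l ^ Suc s) \<in> I"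
        using coords_step[OF I mult a] by (simp add: g(2) sum_distrib_right mult.assoc)
      then have c: "c h = ?c h" for h
        using coords_unique[OF I basis[of "Suc s"], of "f * l ^ d" c] Suc.prems(2) by simp
      \<comment> \<open>Pairing with the right eigenvector \<open>v\<close> turns the action of
        \<open>A j\<close> on coordinate rows into the factor \<open>ev $ j\<close>.\<close>
      have row: "(\<Sum>h\<in>UNIV. A j $ k $ h * v $ h) = ev $ j * v $ k" for j k
        using arg_cong[OF eigen[of j], of "\<lambda>w. w $ k"] by (simp add: matrix_vector_mult_def)
      have "(\<Sum>h\<in>UNIV. c h * v $ h) =
          (\<Sum>h\<in>UNIV. \<Sum>j\<in>UNIV. \<Sum>k\<in>UNIV. a j k * (A j $ k $ h * v $ h))"
        by (simp add: c sum_distrib_right mult.assoc)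
      also have "\<dots> = (\<Sum>j\<in>UNIV. \<Sum>h\<in>UNIV. \<Sum>k\<in>UNIV. a j k * (A j $ k $ h * v $ h))"
        by (rule sum.swap)
      also have "\<dots> = (\<Sum>j\<in>UNIV. \<Sum>k\<in>UNIV. a j k * (\<Sum>h\<in>UNIV. A j $ k $ h * v $ h))"
        by (rule sum.cong[OF refl], subst sum.swap, simp add: sum_distrib_left)
      also have "\<dots> = (\<Sum>j\<in>UNIV. \<Sum>k\<in>UNIV. a j k * (ev $ j * v $ k))"
        by (simp only: row)
      also have "\<dots> = (\<Sum>j\<in>UNIV. ev $ j * (\<Sum>k\<in>UNIV. a j k * v $ k))"
        by (simp add: sum_distrib_left mult_ac)
      also have "\<dots> = (\<Sum>k\<in>UNIV. c0 k * v $ k) * peval f ev"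
        using Suc.IH[OF g(1) a]
        by (simp add: g(2) peval_sum peval_mult sum_distrib_left mult_ac)
      finally show ?case .
    qed
  qed
qed

text \<open>Applying \<open>A j\<close> minus \<open>lam q j\<close> to a relation removes the term
  of \<open>q\<close>, and induction applies to the rest.\<close>

lemma joint_eigenvectors_independent:
  fixes A :: "'j \<Rightarrow> 'k::field ^ 'm::finite ^ 'm"
  assumes "finite F" "\<And>p. p \<in> F \<Longrightarrow> v p \<noteq> 0"
    and "\<And>p j. p \<in> F \<Longrightarrow> A j *v v p = lam p j *s v p"
    and "inj_on lam F" "(\<Sum>p\<in>F. c p *s v p) = 0" "p \<in> F"
  shows "c p = 0"
  using assms
proof (induction F arbitrary: c p rule: finite_induct)
  case empty
  then show ?case by simp
next
  case (insert q F)
  have sum0: "c q *s v q + (\<Sum>p\<in>F. c p *s v p) = 0"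
    using insert by simp
  have "(\<Sum>p\<in>F. (c p * (lam p j - lam q j)) *s v p) = 0" for j
  proof -
    have "A j *v (c q *s v q + (\<Sum>p\<in>F. c p *s v p)) =
        (lam q j * c q) *s v q + (\<Sum>p\<in>F. (c p * lam p j) *s v p)"
      using insert.prems(2)
      by (simp add: vec.add vec.sum vec.scale mult.commute)
    moreover have "lam q j *s (c q *s v q + (\<Sum>p\<in>F. c p *s v p)) =
        (lam q j * c q) *s v q + (\<Sum>p\<in>F. (c p * lam q j) *s v p)"
      by (simp add: vec.scale_right_distrib vec.scale_sum_right mult.commute)
    ultimately have "(\<Sum>p\<in>F. (c p * lam p j) *s v p) = (\<Sum>p\<in>F. (c p * lam q j) *s v p)"
      by (simp add: sum0) (metis add_left_cancel)
    then show ?thesis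
      by (simp add: right_diff_distrib vec.scale_left_diff_distrib sum_subtractf)
  qed
  then have "c p * (lam p j - lam q j) = 0" if "p \<in> F" for p j
    using insert.IH[of "\<lambda>p. c p * (lam p j - lam q j)" p] insert.prems that
    by (auto simp: inj_on_insert)
  \<comment> \<open>The separating index \<open>j\<close> may depend on \<open>p\<close>, so the
    previous step is needed for all \<open>j\<close>.\<close>
  moreover have "\<exists>j. lam p j \<noteq> lam q j" if "p \<in> F" for p
    using insert.hyps insert.prems(3) that unfolding inj_on_def by blast
  ultimately have F: "c p = 0" if "p \<in> F" for p
    using that by fastforce
  then have "c q *s v q = 0"
    using sum0 by simp
  then have "c q = 0"
    using insert.prems(1) by (simp add: vec.scale_eq_0_iff)
  with F insert.prems(5) show ?case by auto
qed

text \<open>An infinite family would have \<open>CARD('m) + 1\<close> members, whose eigenvectors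
  cannot be independent in a space of dimension \<open>CARD('m)\<close>.\<close>

lemma finite_joint_spectrum:
  fixes A :: "'j \<Rightarrow> 'k::field ^ 'm::finite ^ 'm"
  assumes "\<And>p. p \<in> F \<Longrightarrow> v p \<noteq> 0"
    and "\<And>p j. p \<in> F \<Longrightarrow> A j *v v p = lam p j *s v p"
    and "inj_on lam F"
  shows "finite F"
proof (rule ccontr)
  assume "infinite F"
  then obtain L where L: "L \<subseteq> F" "finite L" "card L = Suc CARD('m)"
    by (meson infinite_arbitrarily_large)
  then obtain c where c: "\<exists>p\<in>L. c p \<noteq> 0" "\<forall>k. (\<Sum>p\<in>L. c p * v p $ k) = 0"
    using nontrivial_solution[of UNIV L "\<lambda>p k. v p $ k"] by auto
  have "(\<Sum>p\<in>L. c p *s v p) = 0"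
    using c(2) by (simp add: vec_eq_iff)
  moreover have "inj_on lam L"
    using assms(3) L(1) by (rule inj_on_subset)
  ultimately have "c p = 0" if "p \<in> L" for p
    using joint_eigenvectors_independent[of L v A lam c p] assms(1,2) L that by auto
  with c(1) show False by auto
qed


section \<open>Projective points, their coordinate vectors and vanishing forms\<close>

lemma proj_class_self: "x \<in> proj_class x"
  by (auto simp: proj_class_def intro!: exI[of _ 1])

lemma proj_class_scale:
  assumes "c \<noteq> 0"
  shows "proj_class (c *s x) = proj_class x"
proof -
  have "\<exists>b. a *s x = b *s (c *s x) \<and> b \<noteq> 0" if "a \<noteq> 0" for a
    using assms that by (intro exI[of _ "a / c"]) simp
  with assms show ?thesis
    by (auto simp: proj_class_def)
qed

lemma proj_class_eqD:
  assumes "proj_class x = proj_class y"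
  obtains c where "c \<noteq> 0" "x = c *s y"
  using proj_class_self[of x] unfolding assms by (auto simp: proj_class_def)

lemma proj_zerosD:
  assumes "P \<in> proj_zeros I" "x \<in> P"
  shows "x \<noteq> 0" "P = proj_class x" "\<And>d f. f \<in> I \<Longrightarrow> f \<in> forms d \<Longrightarrow> peval f x = 0"
proof -
  obtain y where y: "P = proj_class y" "y \<noteq> 0"
    using assms(1) by (auto simp: proj_zeros_def proj_space_def)
  with assms(2) obtain c where "x = c *s y" "c \<noteq> 0"
    by (auto simp: proj_class_def)
  with y show "x \<noteq> 0" "P = proj_class x"
    by (simp_all add: proj_class_scale)
  show "\<And>d f. f \<in> I \<Longrightarrow> f \<in> forms d \<Longrightarrow> peval f x = 0"
    using assms by (auto simp: proj_zeros_def)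
qed

text \<open>A form vanishing at \<open>x\<close> vanishes at all multiples of \<open>x\<close>, so a
  single coordinate vector decides.\<close>

lemma proj_zerosI:
  assumes "x \<noteq> 0" "\<And>d f. f \<in> I \<Longrightarrow> f \<in> forms d \<Longrightarrow> peval f x = 0"
  shows "proj_class x \<in> proj_zeros I"
  using assms by (auto simp: proj_zeros_def proj_space_def proj_class_def peval_forms_scale)

lemma value_vector_scale:
  assumes "\<And>k. e k \<in> forms d"
  shows "value_vector e (c *s x) = c ^ d *s value_vector e x"
  using peval_forms_scale[OF assms] by (simp add: value_vector_def vec_eq_iff)

text \<open>Otherwise all forms of degree \<open>d\<close> would vanish at \<open>x\<close>, among
  them the power of a variable whose coordinate is nonzero.\<close>

lemma residue_basis_nonvanishing:
  assumes "residue_basis I d K b" "x \<noteq> 0" "\<And>f. f \<in> I \<Longrightarrow> f \<in> forms d \<Longrightarrow> peval f x = 0"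
  shows "\<exists>k\<in>K. peval (b k) x \<noteq> 0"
proof -
  obtain j where j: "x $ j \<noteq> 0"
    using assms(2) by (auto simp: vec_eq_iff)
  have X: "X j ^ d \<in> forms d"
    using forms_power[OF X_forms, of j d] by simp
  then obtain c where c: "X j ^ d - lincomb K c b \<in> I"
    using residue_basis_span[OF assms(1)] by blast
  moreover have "X j ^ d - lincomb K c b \<in> forms d"
    using X residue_basis_forms[OF assms(1)] by (intro forms_diff forms_sum forms_scalar_mult)
  ultimately have "peval (X j ^ d - lincomb K c b) x = 0"
    by (rule assms(3))
  then have "(x $ j) ^ d = (\<Sum>k\<in>K. c k * peval (b k) x)"
    by (simp add: peval_diff peval_power peval_sum peval_mult)
  with j show ?thesis
    by (metis (no_types, lifting) mult_zero_right power_not_zero sum.neutral)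
qed

lemma eigenvector_of_zero:
  fixes e :: "'m::finite \<Rightarrow> ('v::finite, 'k::field) mpoly" and A :: "'v \<Rightarrow> 'k ^ 'm ^ 'm"
  assumes e: "\<And>k. e k \<in> forms d"
    and el: "residue_basis I (d + 1) UNIV (\<lambda>k. e k * l)"
    and l: "l \<in> forms 1"
    and mult: "\<And>j k. X j * e k - (\<Sum>h\<in>UNIV. scalar (A j $ k $ h) * (e h * l)) \<in> I"
    and x: "x \<noteq> 0" "\<And>i f. f \<in> I \<Longrightarrow> f \<in> forms i \<Longrightarrow> peval f x = 0"
  shows "peval l x \<noteq> 0" "value_vector e x \<noteq> 0"
    "A j *v value_vector e x = (x $ j / peval l x) *s value_vector e x"
proof -
  \<comment> \<open>Using the basis in degree \<open>d + 1\<close> shows at once that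
    \<open>l\<close> and some \<open>e k\<close> do not vanish at \<open>x\<close>.\<close>
  obtain k where "peval (e k * l) x \<noteq> 0"
    using residue_basis_nonvanishing[OF el x(1)] x(2) by blast
  then show lx: "peval l x \<noteq> 0" and "value_vector e x \<noteq> 0"
    by (auto simp: peval_mult value_vector_def vec_eq_iff)
  have "x $ j * peval (e k) x = (\<Sum>h\<in>UNIV. A j $ k $ h * peval (e h) x) * peval l x" for k
  proof -
    \<comment> \<open>Vanishing at \<open>x\<close> is known only for forms in \<open>I\<close>, so
      the relation must first be seen to be homogeneous.\<close>
    have "X j * e k - (\<Sum>h\<in>UNIV. scalar (A j $ k $ h) * (e h * l)) \<in> forms (d + 1)"
      using forms_mult[OF X_forms e, of j k] forms_mult[OF e l]
      by (intro forms_diff forms_sum forms_scalar_mult) (simp_all add: add.commute)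
    with x(2)[OF mult] have "peval (X j * e k - (\<Sum>h\<in>UNIV. scalar (A j $ k $ h) * (e h * l))) x = 0"
      by blast
    then show ?thesis
      by (simp add: peval_diff peval_sum peval_mult sum_distrib_right mult.assoc)
  qed
  with lx show "A j *v value_vector e x = (x $ j / peval l x) *s value_vector e x"
    by (simp add: vec_eq_iff matrix_vector_mult_def value_vector_def field_simps)
qed

lemma zero_of_eigenvector:
  fixes e :: "'m::finite \<Rightarrow> ('v::finite, 'k::field) mpoly" and A :: "'v \<Rightarrow> 'k ^ 'm ^ 'm"
  assumes I: "is_ideal I"
    and basis: "\<And>s. residue_basis I (d + s) UNIV (\<lambda>k. e k * l ^ s)"
    and l: "l \<in> forms 1"
    and mult: "\<And>j k. X j * e k - (\<Sum>h\<in>UNIV. scalar (A j $ k $ h) * (e h * l)) \<in> I"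
    and eigen: "\<And>j. A j *v v = (ev $ j) *s v"
    and v: "v \<noteq> 0"
  obtains C where "C \<noteq> 0" "v = C *s value_vector e ev" "ev \<noteq> 0" "proj_class ev \<in> proj_zeros I"
proof -
  obtain C where C: "\<And>s f c. f \<in> forms s \<Longrightarrow>
      f * l ^ d - lincomb UNIV c (\<lambda>k. e k * l ^ s) \<in> I \<Longrightarrow>
      (\<Sum>k\<in>UNIV. c k * v $ k) = C * peval f ev"
    using eigenfunctional[OF I basis l mult eigen] by blast
  have e: "e k \<in> forms d" for k
    using residue_basis_forms[OF basis[of 0], of k] by simp
  \<comment> \<open>After multiplication by \<open>l ^ d\<close>, both \<open>e k\<close> and
    \<open>e k * l\<close> become basis elements, for \<open>s = d\<close> and
    \<open>s = d + 1\<close>; their coordinates are unit vectors, so \<Phi> takes the value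
    \<open>v $ k\<close> on both.\<close>
  have unit: "(\<Sum>h\<in>UNIV. scalar (if h = k then 1 else 0) * g h) = g k" for g :: "'m \<Rightarrow> ('v, 'k) mpoly" and k
    by (simp add: if_distrib[of scalar] if_distrib[of "\<lambda>y. y * _"] cong: if_cong)
  have unit': "(\<Sum>h\<in>UNIV. (if h = k then 1 else 0) * v $ h) = v $ k" for k
    by (simp add: if_distrib[of "\<lambda>y. y * _"] cong: if_cong)
  have v_eq: "v $ k = C * peval (e k) ev" for k
    using C[OF e[of k], of "\<lambda>h. if h = k then 1 else 0"] ideal_zero[OF I] by (simp add: unit unit')
  \<comment> \<open>The extra factor \<open>l\<close> is what excludes \<open>ev = 0\<close> when \<open>d = 0\<close>.\<close>
  have v_eq': "v $ k = C * peval (e k * l) ev" for k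
    using C[OF forms_mult[OF e l], of k "\<lambda>h. if h = k then 1 else 0"] ideal_zero[OF I]
    by (simp add: unit unit' mult.assoc)
  obtain k where k: "v $ k \<noteq> 0"
    using v by (auto simp: vec_eq_iff)
  show thesis
  proof
    show "C \<noteq> 0"
      using k v_eq by auto
    show "v = C *s value_vector e ev"
      using v_eq by (simp add: value_vector_def vec_eq_iff)
    show ev: "ev \<noteq> 0"
    proof
      assume "ev = 0"
      then have "peval l ev = 0"
        using peval_forms_scale[OF l, of 0 ev] by simp
      with k v_eq' show False by (simp add: peval_mult)
    qed
    show "proj_class ev \<in> proj_zeros I"
    proof (rule proj_zerosI[OF ev])
      fix s f assume f: "f \<in> I" "f \<in> forms s"
      \<comment> \<open>A form in \<open>I\<close> has zero coordinates, hence \<Phi>(f) =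
        0.\<close>
      have "f * l ^ d - lincomb UNIV (\<lambda>_. 0) (\<lambda>k. e k * l ^ s) \<in> I"
        using ideal_mult[OF I f(1), of "l ^ d"] by (simp add: mult.commute)
      from C[OF f(2) this] \<open>C \<noteq> 0\<close> show "peval f ev = 0"
        by simp
    qed
  qed
qed

section \<open>The correspondence between zeros and common eigenvectors\<close>

theorem theorem3p9:
  fixes I :: "('v::finite, 'k::field) mpoly set"
    and e :: "'m::finite \<Rightarrow> ('v, 'k) mpoly"
    and l :: "('v, 'k) mpoly"
    and A :: "'v \<Rightarrow> 'k ^ 'm ^ 'm"
    and rep :: "('k ^ 'v) set \<Rightarrow> 'k ^ 'v"
  assumes "is_ideal I"
    and "proj_dim_zero I"
    and "proj_zeros I \<lesssim> (UNIV :: 'k set)"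
    and "residue_basis I (nz I) UNIV e"
    and "l \<in> forms 1"
    and "residue_basis I (nz I + 1) UNIV (\<lambda>k. e k * l)"
    and "\<And>j k. X j * e k - (\<Sum>h\<in>UNIV. scalar (A j $ k $ h) * (e h * l)) \<in> I"
    and "\<And>P. P \<in> proj_space \<Longrightarrow> rep P \<in> P"
  shows "finite (proj_zeros I) \<and>
    card (proj_class ` {v. common_eigenvector A v}) = card (proj_zeros I) \<and>
    bij_betw (\<lambda>P. proj_class (value_vector e (rep P))) (proj_zeros I)
      (proj_class ` {v. common_eigenvector A v}) \<and>
    (\<forall>P\<in>proj_zeros I. common_eigenvector A (value_vector e (rep P)) \<and>
      (\<forall>ev :: 'k ^ 'v.
        (\<forall>j. A j *v value_vector e (rep P) = (ev $ j) *s value_vector e (rep P)) \<longrightarrow>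
        ev \<noteq> 0 \<and> P = proj_class ev))"
proof -
  let ?d = "nz I" and ?Z = "proj_zeros I"
  note I = assms(1) and e = assms(4) and l = assms(5) and el = assms(6) and mult = assms(7)
  have e_forms: "e k \<in> forms ?d" for k
    using residue_basis_forms[OF e] by simp
  have "dim_piece I i = dim_piece I ?d" if "i \<ge> ?d" for i
    using that by (intro dim_piece_const[OF assms(2)]) (simp add: nz_def)
  then have basis: "residue_basis I (?d + s) UNIV (\<lambda>k. e k * l ^ s)" for s
    by (rule residue_basis_shift[OF I e l mult])
  define val where "val P = value_vector e (rep P)" for P
  \<comment> \<open>The coordinate vector of \<open>P\<close> normalised so that \<open>l\<close>
    takes the value 1; its entries are the eigenvalues.\<close>
  define lam where "lam P = (1 / peval l (rep P)) *s rep P" for P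
  have zero: "rep P \<noteq> 0" "P = proj_class (rep P)"
    "\<And>i f. f \<in> I \<Longrightarrow> f \<in> forms i \<Longrightarrow> peval f (rep P) = 0" if "P \<in> ?Z" for P
    using proj_zerosD[OF that] assms(8)[of P] that by (auto simp: proj_zeros_def)
  have val: "val P \<noteq> 0" "A j *v val P = (lam P $ j) *s val P" "P = proj_class (lam P)" "lam P \<noteq> 0"
    if "P \<in> ?Z" for P j
    using eigenvector_of_zero[OF e_forms el l mult zero(1,3), OF that that] zero(1,2)[OF that]
    by (simp_all add: val_def lam_def proj_class_scale)
  have lam_unique: "ev = lam P" if "P \<in> ?Z" "\<And>j. A j *v val P = (ev $ j) *s val P" for P ev
  proof -
    have "(ev $ j) *s val P = (lam P $ j) *s val P" for j
      using val(2)[OF that(1)] that(2) by simp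
    with val(1)[OF that(1)] show ?thesis
      by (simp add: vec_eq_iff[of ev])
  qed
  have eigen: "common_eigenvector A (val P)" if "P \<in> ?Z" for P
    using val[OF that] by (auto simp: common_eigenvector_def)
  \<comment> \<open>The eigenvalue tuple determines the zero, since \<open>P\<close> is the class of
    \<open>lam P\<close>; this yields finiteness.\<close>
  have "inj_on (\<lambda>P j. lam P $ j) ?Z"
  proof
    fix P Q assume "P \<in> ?Z" "Q \<in> ?Z" "(\<lambda>j. lam P $ j) = (\<lambda>j. lam Q $ j)"
    then have "lam P = lam Q" by (simp add: vec_eq_iff fun_eq_iff)
    with \<open>P \<in> ?Z\<close> \<open>Q \<in> ?Z\<close> show "P = Q" using val(3) by metis
  qed
  with val(1,2) have finite: "finite ?Z"
    by (rule finite_joint_spectrum)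
  have bij: "bij_betw (\<lambda>P. proj_class (val P)) ?Z (proj_class ` {v. common_eigenvector A v})"
  proof (rule bij_betw_imageI)
    show "inj_on (\<lambda>P. proj_class (val P)) ?Z"
    proof
      fix P Q assume PQ: "P \<in> ?Z" "Q \<in> ?Z" "proj_class (val P) = proj_class (val Q)"
      then obtain c where c: "val P = c *s val Q"
        by (elim proj_class_eqD)
      \<comment> \<open>Proportional eigenvectors share their eigenvalues, and these recover the
        point.\<close>
      have "A j *v val P = (lam Q $ j) *s val P" for j
        by (simp add: c vec.scale val(2)[OF PQ(2)] mult.commute)
      with PQ(1) have "lam Q = lam P"
        by (rule lam_unique)
      then show "P = Q"
        using val(3) PQ(1,2) by metis
    qed
    have "proj_class v \<in> (\<lambda>P. proj_class (val P)) ` ?Z" if v: "common_eigenvector A v" for v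
    proof -
      obtain a where "\<And>j. A j *v v = a j *s v"
        using v unfolding common_eigenvector_def by metis
      then have a: "A j *v v = ((\<chi> j. a j) $ j) *s v" for j
        by simp
      define ev where "ev = (\<chi> j. a j)"
      obtain C where C: "C \<noteq> 0" "v = C *s value_vector e ev" "proj_class ev \<in> ?Z"
        using zero_of_eigenvector[OF I basis l mult a] v
        unfolding ev_def common_eigenvector_def by metis
      let ?P = "proj_class ev"
      \<comment> \<open>The chosen representative of the point may differ from \<open>ev\<close> by
        a scalar, which changes the value vector only by a power of that scalar.\<close>
      obtain c where c: "c \<noteq> 0" "rep ?P = c *s ev"
        using zero(2)[OF C(3)] by (metis proj_class_eqD)
      have "val ?P = c ^ ?d *s value_vector e ev"
        unfolding val_def c(2) by (rule value_vector_scale[OF e_forms])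
      with C c have "proj_class (val ?P) = proj_class v"
        by (simp add: proj_class_scale)
      with C(3) show ?thesis by (metis image_eqI)
    qed
    with eigen show "(\<lambda>P. proj_class (val P)) ` ?Z = proj_class ` {v. common_eigenvector A v}"
      by blast
  qed
  have "ev \<noteq> 0 \<and> P = proj_class ev"
    if "P \<in> ?Z" "\<forall>j. A j *v val P = (ev $ j) *s val P" for P and ev :: "'k ^ 'v"
    using lam_unique[of P ev] val(3,4)[OF that(1)] that by simp
  with finite bij bij_betw_same_card[OF bij] eigen show ?thesis
    unfolding val_def by auto
qed

end
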